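(* Let $\lambda\in\mathbb{R}$, let $\alpha>0$, and let $X_\lambda$ be a degenerate zero-truncated Poisson random variable with parameter $\alpha$. Then, for every real $x\ge1$, the cumulative distribution function $F_{X_\lambda}(x)=P\{X_\lambda\le x\}$ is given by $$F_{X_\lambda}(x)=\frac{1}{e_\lambda(\alpha)-1}\Big(e_{\lambda,[x]}(\alpha)-1\Big),$$ where $[x]$ denotes the integral part of $x$.
   Context: For real $x,\lambda$ the $\lambda$-falling factorials are $(x)_{0,\lambda}=1$ and $(x)_{n,\lambda}=x(x-\lambda)(x-2\lambda)\cdots(x-(n-1)\lambda)$ for $n\ge1$. The degenerate exponential is $e_\lambda^x(t)=(1+\lambda t)^{x/\lambda}=\sum_{n=0}^\infty (x)_{n,\lambda}\frac{t^n}{n!}$ (for $\lambda=0$ it is understood as the limit $e^{xt}$), with $e_\lambda(t)=e_\lambda^1(t)$. For $b\in\mathbb{N}$ the truncated function is $$e_{\lambda,b}(a)=\sum_{k=0}^b\frac{a^k}{k!}(1)_{k,\lambda}.$$ A random variable $X_\lambda$ taking values in $\{1,2,3,\dots\}$ is a degenerate zero-truncated Poisson random variable with parameter $\alpha>0$ if its probability mass function is $$P_\lambda(n)=P\{X_\lambda=n\}=\frac{1}{e_\lambda(\alpha)-1}\,\frac{\alpha^n}{n!}\,(1)_{n,\lambda},\qquad n=1,2,3,\dots$$ As part of this definition, $\lambda$ and $\alpha$ are such that this formula is meaningful and is a probability mass function (the values are nonnegative, and the series $\sum_{n\ge 0}(1)_{n,\lambda}\alpha^n/n!$ converges to $e_\lambda(\alpha)$,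 so that the values sum to $1$). *)

theory Defs
  imports "HOL-Probability.Probability"
begin

definition deg_ffact :: "real \<Rightarrow> real \<Rightarrow> nat \<Rightarrow> real" where
  "deg_ffact lam x n = (\<Prod>i<n. x - real i * lam)"

text \<open>
  The closed form of the degenerate exponential, for \<open>1 + lam * t > 0\<close>. Its power series
  expansion is not part of this definition; at \<open>x = 1\<close> it is required separately in
  \<open>deg_ztp_admissible\<close> below.
\<close>

definition deg_exp :: "real \<Rightarrow> real \<Rightarrow> real \<Rightarrow> real" where
  "deg_exp lam x t = (if lam = 0 then exp (x * t) else (1 + lam * t) powr (x / lam))"

definition deg_exp_trunc :: "real \<Rightarrow> nat \<Rightarrow> real \<Rightarrow> real" where
  "deg_exp_trunc lam b a = (\<Sum>k\<le>b. a ^ k / fact k * deg_ffact lam 1 k)"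

definition deg_ztp_mass :: "real \<Rightarrow> real \<Rightarrow> nat \<Rightarrow> real" where
  "deg_ztp_mass lam \<alpha> n = 1 / (deg_exp lam 1 \<alpha> - 1) * (\<alpha> ^ n / fact n) * deg_ffact lam 1 n"

text \<open>
  The parameters for which \<open>deg_ztp_mass\<close> is a probability mass function on the positive
  integers. Together with \<open>\<alpha> > 0\<close>, the two conditions imply \<open>1 + lam * \<alpha> > 0\<close> (for
  \<open>lam * \<alpha> \<le> -1\<close> the series diverges) and \<open>deg_exp lam 1 \<alpha> > 1\<close>, so the values of \<open>powr\<close> at
  non-positive bases and of division by zero play no role.
\<close>

definition deg_ztp_admissible :: "real \<Rightarrow> real \<Rightarrow> bool" where
  "deg_ztp_admissible lam \<alpha> \<longleftrightarrow>
     (\<forall>n\<ge>1. 0 \<le> deg_ztp_mass lam \<alpha> n) \<and>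
     (\<lambda>n. deg_ffact lam 1 n * \<alpha> ^ n / fact n) sums deg_exp lam 1 \<alpha>"

text \<open>
  The random variable is real-valued, with values in the positive integers, so that the
  library's \<open>cdf\<close> applies to its distribution.
\<close>

definition deg_zero_truncated_poisson ::
    "'a measure \<Rightarrow> real \<Rightarrow> real \<Rightarrow> ('a \<Rightarrow> real) \<Rightarrow> bool" where
  "deg_zero_truncated_poisson M lam \<alpha> X \<longleftrightarrow>
     \<alpha> > 0 \<and> deg_ztp_admissible lam \<alpha> \<and>
     X \<in> borel_measurable M \<and>
     (\<forall>\<omega>\<in>space M. \<exists>n\<ge>1. X \<omega> = real n) \<and>
     (\<forall>n\<ge>1. measure M {\<omega> \<in> space M. X \<omega> = real n} = deg_ztp_mass lam \<alpha> n)"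

end

theory Submission
  imports Defs
begin

text \<open>
  A variable with values in the positive integers satisfies \<open>X \<le> x\<close> exactly when it takes one of
  the finitely many values \<open>1, \<dots>, \<lfloor>x\<rfloor>\<close>, so its distribution function is a finite sum of point
  masses (\<open>cdf_positive_integer_valued\<close>). For the masses of the degenerate zero-truncated Poisson
  law, the normalising factor comes out of this sum, and what remains is the truncated degenerate
  exponential without its term of index 0, which equals 1 (\<open>sum_deg_ztp_mass\<close>).
\<close>

lemma (in prob_space) cdf_positive_integer_valued:
  fixes X :: "'a \<Rightarrow> real"
  assumes X: "random_variable borel X"
    and vals: "\<And>\<omega>. \<omega> \<in> space M \<Longrightarrow> \<exists>n\<ge>1. X \<omega> = real n"
  shows "cdf (distr M borel X) x
           = (\<Sum>n\<in>{1..nat \<lfloor>x\<rfloor>}. prob {\<omega> \<in> space M. X \<omega> = real n})"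
proof -
  have le_iff: "real n \<le> x \<longleftrightarrow> n \<le> nat \<lfloor>x\<rfloor>" if "n \<ge> 1" for n
    using that by linarith
  have "cdf (distr M borel X) x = prob (X -` {..x} \<inter> space M)"
    unfolding cdf_def using X by (simp add: measure_distr)
  also have "X -` {..x} \<inter> space M
      = (\<Union>n\<in>{1..nat \<lfloor>x\<rfloor>}. {\<omega> \<in> space M. X \<omega> = real n})"
    using vals le_iff by fastforce
  also have "prob \<dots> = (\<Sum>n\<in>{1..nat \<lfloor>x\<rfloor>}. prob {\<omega> \<in> space M. X \<omega> = real n})"
    using X by (intro finite_measure_finite_Union) (auto simp: disjoint_family_on_def)
  finally show ?thesis .
qed

lemma sum_deg_ztp_mass:
  "(\<Sum>n\<in>{1..b}. deg_ztp_mass lam \<alpha> n)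
     = 1 / (deg_exp lam 1 \<alpha> - 1) * (deg_exp_trunc lam b \<alpha> - 1)"
proof -
  have "deg_exp_trunc lam b \<alpha> = 1 + (\<Sum>n\<in>{1..b}. \<alpha> ^ n / fact n * deg_ffact lam 1 n)"
    unfolding deg_exp_trunc_def
    by (simp add: atMost_atLeast0 sum.atLeast_Suc_atMost deg_ffact_def)
  then show ?thesis
    by (simp add: deg_ztp_mass_def sum_distrib_left mult.assoc)
qed

theorem theorem2p4:
  fixes M :: "'a measure" and X :: "'a \<Rightarrow> real" and lam \<alpha> x :: real
  assumes "prob_space M"
    and "\<alpha> > 0"
    and "deg_zero_truncated_poisson M lam \<alpha> X"
    and "x \<ge> 1"
  shows "cdf (distr M borel X) x
           = 1 / (deg_exp lam 1 \<alpha> - 1) * (deg_exp_trunc lam (nat \<lfloor>x\<rfloor>) \<alpha> - 1)"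
proof -
  have X: "X \<in> borel_measurable M"
    and vals: "\<And>\<omega>. \<omega> \<in> space M \<Longrightarrow> \<exists>n\<ge>1. X \<omega> = real n"
    and mass: "\<And>n. n \<ge> 1 \<Longrightarrow> measure M {\<omega> \<in> space M. X \<omega> = real n} = deg_ztp_mass lam \<alpha> n"
    using assms(3) by (auto simp: deg_zero_truncated_poisson_def)
  have "cdf (distr M borel X) x
      = (\<Sum>n\<in>{1..nat \<lfloor>x\<rfloor>}. measure M {\<omega> \<in> space M. X \<omega> = real n})"
    by (rule prob_space.cdf_positive_integer_valued[OF assms(1) X vals])
  also have "\<dots> = (\<Sum>n\<in>{1..nat \<lfloor>x\<rfloor>}. deg_ztp_mass lam \<alpha> n)"
    by (intro sum.cong) (auto simp: mass)
  finally show ?thesis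
    by (simp only: sum_deg_ztp_mass)
qed

end
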